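(* Let $1<k<n-1$, let $r\ge n-k+1$, and let $B=\varepsilon I$ with $\varepsilon\in\mathbb C$ and $I$ the $n\times n$ identity matrix. Then, in $H^0(\mathrm{Sym}^r(\mathcal S^*\otimes\mathcal S))$ on $G(k,n)$, $$h(\kappa_{(r)})=\sum_{j=0}^{k+r-n-1}\varepsilon^j\binom{k+r-n-1}{j}\,\kappa_{(1)}^j\,\tilde\kappa_{(r-j)} .$$
   Context: $\mathcal S$ is the tautological subbundle on the Grassmannian $G(k,n)$. $h:\mathcal S^*\otimes\mathcal S\to\mathcal S^*\otimes\mathcal S$ is the bundle map $h(\sigma)=\sigma+\varepsilon\,(\mathrm{tr}\,\sigma)\,\mathrm{id}_{\mathcal S}$; $h$ also denotes the induced map on $\mathrm{Sym}^r(\mathcal S^*\otimes\mathcal S)$ and on its global sections. Products are taken in the ring $\bigoplus_rH^0(\mathrm{Sym}^r(\mathcal S^*\otimes\mathcal S))$. $\kappa_{(r)}\in H^0(\mathrm{Sym}^r(\mathcal S^*\otimes\mathcal S))$ is the section corresponding to the identity bundle map of $\mathrm{Sym}^r\mathcal S$, with components $\frac1{r!}\sum_{\pi\in S_r}\delta^{a_{\pi(1)}}_{b_1}\cdots\delta^{a_{\pi(r)}}_{b_r}$; equivalently, regarding sections of $\mathrm{Sym}^r(\mathcal S^*\otimes\mathcal S)$ as degree-$r$ polynomial functions on $\mathrm{End}(\mathcal S)$ via the trace pairing, $\kappa_{(r)}$ is $\phi\mapsto\mathrm{tr}(\mathrm{Sym}^r\phi)$. $\kappa_{(0)}=1$.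 $\tilde\kappa_{(r)}:=\sum_{i=0}^{\min\{r,n\}}I_i\,\kappa_{(r-i)}\kappa_{(1)}^i$, where $I_i=I_i(B)$ is the coefficient of $t^{n-i}$ in $\det(tI+B)$ (so here $I_i=\binom ni\varepsilon^i$). *)

theory Defs
  imports
    "HOL-Analysis.Analysis"
    "HOL-Combinatorics.Permutations"
    "HOL-Computational_Algebra.Polynomial"
    "HOL-Library.Function_Algebras"
begin

text \<open>
  Maps whose domain is a carrier set are extended by zero to the ambient type. Such maps are
  closed under the pointwise operations of \<^theory>\<open>HOL-Library.Function_Algebras\<close>, and equality
  of the extended maps is equality on the carrier.
\<close>

definition lin_maps ::
  "(complex \<Rightarrow> 'a \<Rightarrow> 'a) \<Rightarrow> 'a::plus set \<Rightarrow> (complex \<Rightarrow> 'b \<Rightarrow> 'b) \<Rightarrow> 'b::{plus,zero} set \<Rightarrow> ('a \<Rightarrow> 'b) set"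
  where "lin_maps sa A sb B =
    {f. (\<forall>x\<in>A. f x \<in> B) \<and> (\<forall>x. x \<notin> A \<longrightarrow> f x = 0) \<and>
        (\<forall>x\<in>A. \<forall>y\<in>A. f (x + y) = f x + f y) \<and> (\<forall>c. \<forall>x\<in>A. f (sa c x) = sb c (f x))}"


subsection \<open>The Grassmannian and the bundle of endomorphisms of its tautological subbundle\<close>

definition Grass :: "nat \<Rightarrow> (complex^'n) set set"
  where "Grass k = {W. vec.subspace W \<and> vec.dim W = k}"

text \<open>
  The fibre of the tautological subbundle at \<open>W\<close> is \<open>W\<close> itself; the fibre of
  \<open>\<S>\<^sup>* \<otimes> \<S>\<close> is \<open>End W\<close>, a decomposable tensor \<open>\<lambda> \<otimes> w\<close> being the map \<open>x \<mapsto> \<lambda>(x) w\<close>.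
\<close>

definition End :: "(complex^'n) set \<Rightarrow> (complex^'n \<Rightarrow> complex^'n) set"
  where "End W = lin_maps (*s) W (*s) W"

definition scale_end :: "complex \<Rightarrow> (complex^'n \<Rightarrow> complex^'n) \<Rightarrow> complex^'n \<Rightarrow> complex^'n"
  where "scale_end c \<sigma> = (\<lambda>x. c *s \<sigma> x)"

definition id_end :: "(complex^'n) set \<Rightarrow> complex^'n \<Rightarrow> complex^'n"
  where "id_end W = (\<lambda>x. if x \<in> W then x else 0)"

definition some_basis :: "(complex^'n) set \<Rightarrow> (complex^'n) set"
  where "some_basis W = (SOME \<B>. \<B> \<subseteq> W \<and> vec.independent \<B> \<and> vec.span \<B> = W)"

definition tr_end :: "(complex^'n) set \<Rightarrow> (complex^'n \<Rightarrow> complex^'n) \<Rightarrow> complex"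
  where "tr_end W \<sigma> = (let \<B> = some_basis W in \<Sum>v\<in>\<B>. vec.representation \<B> (\<sigma> v) v)"

definition h_end ::
  "complex \<Rightarrow> (complex^'n) set \<Rightarrow> (complex^'n \<Rightarrow> complex^'n) \<Rightarrow> complex^'n \<Rightarrow> complex^'n"
  where "h_end \<epsilon> W \<sigma> =
    (if \<sigma> \<in> End W then \<sigma> + scale_end (\<epsilon> * tr_end W \<sigma>) (id_end W) else 0)"


subsection \<open>Symmetric powers of \<open>End W\<close>\<close>

definition dual_end :: "(complex^'n) set \<Rightarrow> ((complex^'n \<Rightarrow> complex^'n) \<Rightarrow> complex) set"
  where "dual_end W = lin_maps scale_end (End W) (*) UNIV"

text \<open>
  In characteristic 0 the symmetric algebra of a finite-dimensional space \<open>E\<close> is the algebra of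
  polynomial functions on \<open>E\<^sup>*\<close>: the product \<open>e\<^sub>0 \<cdots> e\<^sub>r\<^sub>-\<^sub>1\<close> is the function
  \<open>\<xi> \<mapsto> \<xi>(e\<^sub>0) \<cdots> \<xi>(e\<^sub>r\<^sub>-\<^sub>1)\<close>, these products span the \<open>r\<close>-th symmetric power, and
  multiplication is pointwise. Identifying \<open>(End W)\<^sup>*\<close> with \<open>End W\<close> by the trace pairing gives
  the polynomial functions on \<open>End W\<close>.
\<close>

definition sym_prod ::
  "(complex^'n) set \<Rightarrow> nat \<Rightarrow> (nat \<Rightarrow> complex^'n \<Rightarrow> complex^'n)
    \<Rightarrow> ((complex^'n \<Rightarrow> complex^'n) \<Rightarrow> complex) \<Rightarrow> complex"
  where "sym_prod W r e = (\<lambda>\<xi>. if \<xi> \<in> dual_end W then \<Prod>i<r. \<xi> (e i) else 0)"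

definition Sym_end ::
  "nat \<Rightarrow> (complex^'n) set \<Rightarrow> (((complex^'n \<Rightarrow> complex^'n) \<Rightarrow> complex) \<Rightarrow> complex) set"
  where "Sym_end r W =
    {(\<lambda>\<xi>. \<Sum>j<N. c j * sym_prod W r (e j) \<xi>) | (N::nat) c e. \<forall>j<N. \<forall>i<r. e j i \<in> End W}"

text \<open>
  The map of symmetric algebras induced by a linear map \<open>L : End W \<rightarrow> End W\<close>, namely composition
  with the transpose of \<open>L\<close>; lemma \<open>sym_map_sym_prod\<close> below is its defining property.
\<close>

definition transpose_end ::
  "(complex^'n) set \<Rightarrow> ((complex^'n \<Rightarrow> complex^'n) \<Rightarrow> complex^'n \<Rightarrow> complex^'n)
    \<Rightarrow> ((complex^'n \<Rightarrow> complex^'n) \<Rightarrow> complex) \<Rightarrow> (complex^'n \<Rightarrow> complex^'n) \<Rightarrow> complex"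
  where "transpose_end W L \<xi> = (\<lambda>\<sigma>. if \<sigma> \<in> End W then \<xi> (L \<sigma>) else 0)"

definition sym_map ::
  "(complex^'n) set \<Rightarrow> ((complex^'n \<Rightarrow> complex^'n) \<Rightarrow> complex^'n \<Rightarrow> complex^'n)
    \<Rightarrow> (((complex^'n \<Rightarrow> complex^'n) \<Rightarrow> complex) \<Rightarrow> complex)
    \<Rightarrow> ((complex^'n \<Rightarrow> complex^'n) \<Rightarrow> complex) \<Rightarrow> complex"
  where "sym_map W L f = (\<lambda>\<xi>. if \<xi> \<in> dual_end W then f (transpose_end W L \<xi>) else 0)"


subsection \<open>Global sections\<close>

type_synonym 'n sym_section =
  "(complex^'n) set \<Rightarrow> ((complex^'n \<Rightarrow> complex^'n) \<Rightarrow> complex) \<Rightarrow> complex"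

text \<open>
  The tautological bundle is homogeneous under the general linear group: an invertible \<open>g\<close>
  identifies \<open>W\<close> with \<open>g W\<close>, and \<open>push_dual g W\<close> is the induced identification of
  \<open>(End W)\<^sup>*\<close> with \<open>(End (g W))\<^sup>*\<close>, \<open>(g \<xi>)(\<tau>) = \<xi>(g\<^sup>-\<^sup>1 \<tau> g)\<close>.
\<close>

definition translate :: "complex^'n^'n \<Rightarrow> (complex^'n) set \<Rightarrow> (complex^'n) set"
  where "translate g W = (\<lambda>x. g *v x) ` W"

definition push_dual ::
  "complex^'n^'n \<Rightarrow> (complex^'n) set \<Rightarrow> ((complex^'n \<Rightarrow> complex^'n) \<Rightarrow> complex)
    \<Rightarrow> (complex^'n \<Rightarrow> complex^'n) \<Rightarrow> complex"
  where "push_dual g W \<xi> = (\<lambda>\<tau>. if \<tau> \<in> End (translate g W)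
      then \<xi> (\<lambda>x. if x \<in> W then matrix_inv g *v \<tau> (g *v x) else 0) else 0)"

definition complex_differentiable_at :: "(complex^'n^'n \<Rightarrow> complex) \<Rightarrow> complex^'n^'n \<Rightarrow> bool"
  where "complex_differentiable_at f g \<longleftrightarrow>
    (\<exists>D. (f has_derivative D) (at g) \<and> (\<forall>c X. D (\<chi> i j. c * X $ i $ j) = c * D X))"

text \<open>
  The orbit map \<open>g \<mapsto> g W\<close> is a holomorphic submersion of the general linear group onto the
  Grassmannian, along which the tautological bundle is trivialised by the identifications above.
  Hence a section is holomorphic iff its pullback, a function on the group with values in
  \<open>Sym\<^sup>r (End W)\<close>, is holomorphic.
\<close>

definition holomorphic_section :: "nat \<Rightarrow> 'n::finite sym_section \<Rightarrow> bool"
  where "holomorphic_section k s \<longleftrightarrow>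
    (\<forall>W\<in>Grass k. \<forall>\<xi>\<in>dual_end W. \<forall>g. invertible g \<longrightarrow>
       complex_differentiable_at (\<lambda>g. s (translate g W) (push_dual g W \<xi>)) g)"

definition H0_Sym :: "nat \<Rightarrow> nat \<Rightarrow> 'n::finite sym_section set"
  where "H0_Sym k r = {s. (\<forall>W\<in>Grass k. s W \<in> Sym_end r W) \<and> (\<forall>W. W \<notin> Grass k \<longrightarrow> s W = 0) \<and>
      holomorphic_section k s}"

definition h_section :: "complex \<Rightarrow> nat \<Rightarrow> 'n::finite sym_section \<Rightarrow> 'n sym_section"
  where "h_section \<epsilon> k s = (\<lambda>W. if W \<in> Grass k then sym_map W (h_end \<epsilon> W) (s W) else 0)"

text \<open>
  Sums, products and powers of sections are the pointwise ones. The power \<open>s ^ 0\<close> is the constant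
  function 1, which is 1 also outside the carriers, but it acts as the unit on every section.
\<close>

definition scale_section :: "complex \<Rightarrow> 'n::finite sym_section \<Rightarrow> 'n sym_section"  (infixr "\<odot>" 75)
  where "c \<odot> s = (\<lambda>W \<xi>. c * s W \<xi>)"


subsection \<open>The sections \<open>\<kappa>\<close>\<close>

text \<open>
  \<open>dyad \<B> v w\<close> is the element \<open>w\<^sup>* \<otimes> v\<close> of \<open>End (span \<B>)\<close>, with \<open>w\<^sup>*\<close> from the dual basis of
  \<open>\<B>\<close>; the library makes \<open>vec.representation\<close> vanish outside the span.
\<close>

definition dyad :: "(complex^'n) set \<Rightarrow> complex^'n \<Rightarrow> complex^'n \<Rightarrow> complex^'n \<Rightarrow> complex^'n"
  where "dyad \<B> v w = (\<lambda>x. vec.representation \<B> x w *s v)"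

definition kappa_component :: "nat \<Rightarrow> (nat \<Rightarrow> 'b) \<Rightarrow> (nat \<Rightarrow> 'b) \<Rightarrow> complex"
  where "kappa_component r a b =
    1 / fact r * (\<Sum>\<pi> | \<pi> permutes {..<r}. \<Prod>i<r. if a (\<pi> i) = b i then 1 else 0)"

text \<open>The indices \<open>a\<close>, \<open>b\<close> of the components range over tuples of basis vectors.\<close>

definition kappa :: "nat \<Rightarrow> nat \<Rightarrow> 'n::finite sym_section"
  where "kappa k r = (\<lambda>W. if W \<in> Grass k
      then (\<lambda>\<xi>. let \<B> = some_basis W in
        \<Sum>a \<in> {..<r} \<rightarrow>\<^sub>E \<B>. \<Sum>b \<in> {..<r} \<rightarrow>\<^sub>E \<B>.
          kappa_component r a b * sym_prod W r (\<lambda>i. dyad \<B> (a i) (b i)) \<xi>)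
      else 0)"

definition char_coeff :: "complex^'n^'n \<Rightarrow> nat \<Rightarrow> complex"
  where "char_coeff B i =
    poly.coeff (det (mat [:0, 1:] + (\<chi> p q. [:B $ p $ q:]))) (CARD('n) - i)"

definition kappa_tilde :: "complex^'n^'n \<Rightarrow> nat \<Rightarrow> nat \<Rightarrow> 'n::finite sym_section"
  where "kappa_tilde B k r =
    (\<Sum>i = 0..min r CARD('n). char_coeff B i \<odot> (kappa k (r - i) * kappa k 1 ^ i))"


subsection \<open>Functoriality of the symmetric powers\<close>

lemma End_add:
  assumes W: "vec.subspace W" and "\<sigma> \<in> End W" "\<tau> \<in> End W"
  shows "\<sigma> + \<tau> \<in> End W"
proof -
  have "(\<sigma> + \<tau>) (x + y) = (\<sigma> + \<tau>) x + (\<sigma> + \<tau>) y" if "x \<in> W" "y \<in> W" for x y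
    using that assms by (simp add: End_def lin_maps_def add_ac)
  with assms show ?thesis
    by (simp add: End_def lin_maps_def vec.subspace_add vec.scale_right_distrib)
qed

lemma End_scale:
  assumes W: "vec.subspace W" and "\<sigma> \<in> End W"
  shows "scale_end c \<sigma> \<in> End W"
  using assms
  by (simp add: End_def lin_maps_def scale_end_def vec.subspace_scale vec.scale_right_distrib mult_ac)

lemma id_end_End:
  assumes "vec.subspace W"
  shows "id_end W \<in> End W"
  using assms by (auto simp: End_def lin_maps_def id_end_def vec.subspace_def)

lemma some_basis:
  assumes "vec.subspace W"
  shows "some_basis W \<subseteq> W" "vec.independent (some_basis W)" "vec.span (some_basis W) = W"
proof -
  obtain \<B> where \<B>: "\<B> \<subseteq> W" "vec.independent \<B>" "W \<subseteq> vec.span \<B>"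
    by (rule vec.basis_exists)
  have "vec.span \<B> \<subseteq> W"
    by (rule vec.span_minimal[OF \<B>(1) assms])
  with \<B> have "\<B> \<subseteq> W \<and> vec.independent \<B> \<and> vec.span \<B> = W"
    by (simp add: subset_antisym)
  then have *: "some_basis W \<subseteq> W \<and> vec.independent (some_basis W) \<and> vec.span (some_basis W) = W"
    unfolding some_basis_def by (rule someI)
  show "some_basis W \<subseteq> W" "vec.independent (some_basis W)" "vec.span (some_basis W) = W"
    using * by simp_all
qed

lemma h_end_linear:
  assumes W: "vec.subspace W"
  shows "h_end \<epsilon> W \<in> lin_maps scale_end (End W) scale_end (End W)"
proof -
  note B = some_basis[OF W]
  have in_span: "\<sigma> v \<in> vec.span (some_basis W)" if "\<sigma> \<in> End W" "v \<in> some_basis W" for \<sigma> v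
    using that B by (auto simp: End_def lin_maps_def)
  have tr_add: "tr_end W (\<sigma> + \<tau>) = tr_end W \<sigma> + tr_end W \<tau>"
    if "\<sigma> \<in> End W" "\<tau> \<in> End W" for \<sigma> \<tau>
    using that in_span B
    by (simp add: tr_end_def Let_def vec.representation_add sum.distrib)
  have tr_scale: "tr_end W (scale_end c \<sigma>) = c * tr_end W \<sigma>" if "\<sigma> \<in> End W" for c \<sigma>
    using that in_span B
    by (simp add: tr_end_def Let_def scale_end_def vec.representation_scale sum_distrib_left)
  have scale_add: "scale_end (c + d) \<sigma> = scale_end c \<sigma> + scale_end d \<sigma>"
    for c d and \<sigma> :: "complex^'n \<Rightarrow> complex^'n"
    by (simp add: scale_end_def fun_eq_iff vec.scale_left_distrib)
  have scale_sum: "scale_end c (\<sigma> + \<tau>) = scale_end c \<sigma> + scale_end c \<tau>"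
    for c and \<sigma> \<tau> :: "complex^'n \<Rightarrow> complex^'n"
    by (simp add: scale_end_def fun_eq_iff vec.scale_right_distrib)
  have scale_scale: "scale_end c (scale_end d \<sigma>) = scale_end (c * d) \<sigma>"
    for c d and \<sigma> :: "complex^'n \<Rightarrow> complex^'n"
    by (simp add: scale_end_def)
  have h: "h_end \<epsilon> W \<sigma> = \<sigma> + scale_end (\<epsilon> * tr_end W \<sigma>) (id_end W)" if "\<sigma> \<in> End W" for \<sigma>
    using that by (simp add: h_end_def)
  have "h_end \<epsilon> W \<sigma> \<in> End W" if "\<sigma> \<in> End W" for \<sigma>
    unfolding h[OF that] by (intro End_add End_scale id_end_End W that)
  moreover have "h_end \<epsilon> W (\<sigma> + \<tau>) = h_end \<epsilon> W \<sigma> + h_end \<epsilon> W \<tau>"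
    if "\<sigma> \<in> End W" "\<tau> \<in> End W" for \<sigma> \<tau>
    unfolding h[OF that(1)] h[OF that(2)] h[OF End_add[OF W that]] tr_add[OF that]
      distrib_left scale_add by (simp only: add_ac)
  moreover have "h_end \<epsilon> W (scale_end c \<sigma>) = scale_end c (h_end \<epsilon> W \<sigma>)"
    if "\<sigma> \<in> End W" for c \<sigma>
    unfolding h[OF that] h[OF End_scale[OF W that]] tr_scale[OF that] scale_sum scale_scale
    by (simp only: mult_ac)
  ultimately show ?thesis
    unfolding lin_maps_def by (simp add: h_end_def)
qed

lemma transpose_end_dual:
  assumes \<xi>: "\<xi> \<in> dual_end W" and W: "vec.subspace W"
    and L: "L \<in> lin_maps scale_end (End W) scale_end (End W)"
  shows "transpose_end W L \<xi> \<in> dual_end W"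
proof -
  have L_in: "L \<sigma> \<in> End W" if "\<sigma> \<in> End W" for \<sigma>
    using L that by (simp add: lin_maps_def)
  have "\<xi> (L (\<sigma> + \<tau>)) = \<xi> (L \<sigma>) + \<xi> (L \<tau>)" if "\<sigma> \<in> End W" "\<tau> \<in> End W" for \<sigma> \<tau>
    using L \<xi> that L_in[OF that(1)] L_in[OF that(2)] by (simp add: lin_maps_def dual_end_def)
  moreover have "\<xi> (L (scale_end c \<sigma>)) = c * \<xi> (L \<sigma>)" if "\<sigma> \<in> End W" for c \<sigma>
    using L \<xi> that L_in[OF that] by (simp add: lin_maps_def dual_end_def)
  ultimately show ?thesis
    unfolding dual_end_def lin_maps_def transpose_end_def
    by (simp add: End_add[OF W] End_scale[OF W])
qed

lemma sym_map_sym_prod: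
  assumes "vec.subspace W" and "L \<in> lin_maps scale_end (End W) scale_end (End W)"
    and "\<And>i. i < r \<Longrightarrow> e i \<in> End W"
  shows "sym_map W L (sym_prod W r e) = sym_prod W r (\<lambda>i. L (e i))"
proof
  fix \<xi>
  show "sym_map W L (sym_prod W r e) \<xi> = sym_prod W r (\<lambda>i. L (e i)) \<xi>"
  proof (cases "\<xi> \<in> dual_end W")
    case True
    then have "sym_map W L (sym_prod W r e) \<xi> = (\<Prod>i<r. transpose_end W L \<xi> (e i))"
      using transpose_end_dual[OF _ assms(1,2)] by (simp add: sym_map_def sym_prod_def)
    also have "\<dots> = (\<Prod>i<r. \<xi> (L (e i)))"
      by (rule prod.cong) (use assms(3) in \<open>simp_all add: transpose_end_def\<close>)
    finally show ?thesis
      using True by (simp add: sym_prod_def)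
  qed (simp add: sym_map_def sym_prod_def)
qed

end

theory Submission
  imports Defs
begin

text \<open>
  In a basis of the fibre \<open>W\<close>, a point \<open>\<xi>\<close> of the dual of \<open>End W\<close> is a \<open>k \<times> k\<close> matrix \<open>M\<close>, and
  \<open>\<kappa>\<^sub>r(\<xi>)\<close> is the complete homogeneous symmetric function \<open>h\<^sub>r\<close> of its eigenvalues. The transpose of
  \<open>h\<close> replaces \<open>M\<close> by \<open>M + \<epsilon> tr(M) I\<close>. In \<open>r! h\<^sub>r(M + s I)\<close>, a sum over permutations of \<open>r\<close> factors,
  each factor can be taken from \<open>M\<close> or from \<open>s I\<close>; deleting one identity factor contributes
  \<open>k + r - 1\<close>: \<open>k\<close> if it is a fixed point and 1 for each of the \<open>r - 1\<close> other places in a cycle. Hence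
  \<open>h\<^sub>r(M + s I) = \<Sum>\<^sub>l (k + r - 1 choose l) s\<^sup>l h\<^sub>r\<^sub>-\<^sub>l(M)\<close>, and the theorem is Vandermonde's identity for
  \<open>k + r - 1 = (k + r - n - 1) + n\<close>. Since \<open>\<kappa>\<^sub>r\<close> does not depend on the basis, its pullback to the general
  linear group is constant, which gives holomorphy.
\<close>

subsection \<open>Traces on symmetric powers\<close>

text \<open>The polarised form of the trace on a symmetric power: each \<open>\<pi>\<close>
  contributes the trace of the tensor product of the \<open>M i\<close> composed with a permutation
  of the factors. Letting the matrix depend on the position makes it possible to replace single
  factors by the identity and delete them.\<close>

definition mixed_trace :: "'i set \<Rightarrow> 'b set \<Rightarrow> ('i \<Rightarrow> 'b \<Rightarrow> 'b \<Rightarrow> 'c) \<Rightarrow> 'c::comm_ring_1"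
  where "mixed_trace A B M =
    (\<Sum>\<pi> | \<pi> permutes A. \<Sum>a \<in> A \<rightarrow>\<^sub>E B. \<Prod>i\<in>A. M i (a i) (a (\<pi> i)))"

lemma mixed_trace_cong:
  assumes "\<And>i v w. i \<in> A \<Longrightarrow> v \<in> B \<Longrightarrow> w \<in> B \<Longrightarrow> M i v w = N i v w"
  shows "mixed_trace A B M = mixed_trace A B N"
  unfolding mixed_trace_def
proof (intro sum.cong refl prod.cong)
  fix \<pi> a i assume "\<pi> \<in> {\<pi>. \<pi> permutes A}" "a \<in> A \<rightarrow>\<^sub>E B" "i \<in> A"
  then show "M i (a i) (a (\<pi> i)) = N i (a i) (a (\<pi> i))"
    by (intro assms) (auto simp: permutes_in_image)
qed

lemma sum_PiE_insert:
  assumes "x \<notin> A"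
  shows "(\<Sum>a \<in> insert x A \<rightarrow>\<^sub>E B. f a) = (\<Sum>v\<in>B. \<Sum>a \<in> A \<rightarrow>\<^sub>E B. f (a(x := v)))"
  unfolding PiE_insert_eq
  by (subst sum.reindex[OF inj_combinator[OF assms]])
     (simp add: sum.cartesian_product case_prod_unfold)

text \<open>
  A permutation of \<open>insert x A\<close> is \<open>(x b) \<circ> q\<close> with \<open>q\<close> a permutation of \<open>A\<close>; the identity matrix in
  position \<open>x\<close> forces \<open>a x = a b\<close>, so that \<open>a \<circ> (x b) = a\<close> and the term of \<open>q\<close> remains.
\<close>

lemma mixed_trace_insert_identity:
  fixes M :: "'i \<Rightarrow> 'b \<Rightarrow> 'b \<Rightarrow> 'c::comm_ring_1"
  assumes "finite A" "x \<notin> A" "finite B"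
    and M: "\<And>v w. v \<in> B \<Longrightarrow> w \<in> B \<Longrightarrow> M x v w = of_bool (v = w)"
  shows "mixed_trace (insert x A) B M = of_nat (card B + card A) * mixed_trace A B M"
proof -
  let ?P = "\<lambda>q a. \<Prod>i\<in>A. M i (a i) (a (q i))"
  have inner: "(\<Prod>i\<in>insert x A. M i ((a(x := v)) i) ((a(x := v)) ((Transposition.transpose x b \<circ> q) i))) =
      of_bool (v = (a(x := v)) b) * ?P q a"
    if "b \<in> insert x A" "q permutes A" "v \<in> B" "a \<in> A \<rightarrow>\<^sub>E B" for b q v a
  proof -
    let ?a = "a(x := v)"
    have qx: "q x = x" and qA: "\<And>i. i \<in> A \<Longrightarrow> q i \<in> A"
      using that assms(2) by (simp_all add: permutes_not_in permutes_in_image)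
    have "?a b \<in> B" using that by auto
    have "(\<Prod>i\<in>insert x A. M i (?a i) (?a ((Transposition.transpose x b \<circ> q) i))) =
        of_bool (v = ?a b) * (\<Prod>i\<in>A. M i (?a i) (?a (Transposition.transpose x b (q i))))"
      unfolding prod.insert[OF assms(1,2)] using M[OF \<open>v \<in> B\<close> \<open>?a b \<in> B\<close>]
      by (simp only: o_def qx transpose_apply_first fun_upd_same)
    also have "\<dots> = of_bool (v = ?a b) * ?P q a"
    proof (cases "v = ?a b")
      case True
      then have swap: "?a (Transposition.transpose x b y) = ?a y" for y
        by (cases "b = x") (auto simp: Transposition.transpose_def)
      have "(\<Prod>i\<in>A. M i (?a i) (?a (Transposition.transpose x b (q i)))) = ?P q a"
        unfolding swap by (rule prod.cong) (use assms(2) qA in auto)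
      then show ?thesis by simp
    qed simp
    finally show ?thesis .
  qed
  \<comment> \<open>For \<open>b = x\<close> the new position is a fixed point and \<open>v\<close>
    is free; for \<open>b\<close> in \<open>A\<close> the only admissible value is
    \<open>a b\<close>.\<close>
  have count: "(\<Sum>v\<in>B. of_bool (v = (a(x := v)) b)) = (if b = x then of_nat (card B) else 1 :: 'c)"
    if "b \<in> insert x A" "a \<in> A \<rightarrow>\<^sub>E B" for a b
  proof (cases "b = x")
    case False
    then have "a b \<in> B" using that by auto
    with False show ?thesis using assms(3) by (simp add: of_bool_def)
  qed simp
  have "mixed_trace (insert x A) B M = (\<Sum>b\<in>insert x A. \<Sum>q | q permutes A.
      \<Sum>v\<in>B. \<Sum>a \<in> A \<rightarrow>\<^sub>E B. of_bool (v = (a(x := v)) b) * ?P q a)"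
    unfolding mixed_trace_def sum_over_permutations_insert[OF assms(1,2)] sum_PiE_insert[OF assms(2)]
    by (intro sum.cong refl inner) auto
  also have "\<dots> = (\<Sum>b\<in>insert x A. \<Sum>q | q permutes A. \<Sum>a \<in> A \<rightarrow>\<^sub>E B.
      (\<Sum>v\<in>B. of_bool (v = (a(x := v)) b)) * ?P q a)"
    unfolding sum_distrib_right by (intro sum.cong refl sum.swap)
  also have "\<dots> = (\<Sum>b\<in>insert x A. \<Sum>q | q permutes A. \<Sum>a \<in> A \<rightarrow>\<^sub>E B.
      (if b = x then of_nat (card B) else 1) * ?P q a)"
    by (intro sum.cong refl) (simp only: count)
  also have "\<dots> = (\<Sum>b\<in>insert x A. (if b = x then of_nat (card B) else 1) * mixed_trace A B M)"
    by (simp only: mixed_trace_def sum_distrib_left)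
  also have "\<dots> = of_nat (card B) * mixed_trace A B M
      + (\<Sum>b\<in>A. (if b = x then of_nat (card B) else 1) * mixed_trace A B M)"
    using assms(1,2) by simp
  also have "(\<Sum>b\<in>A. (if b = x then of_nat (card B) else 1) * mixed_trace A B M) =
      (\<Sum>b\<in>A. mixed_trace A B M)"
    by (rule sum.cong) (use assms(2) in auto)
  finally show ?thesis by (simp add: algebra_simps)
qed

text \<open>The identity positions are deleted one at a time. When \<open>j\<close> of them are left
  besides \<open>A\<close>, the next one to be added back contributes
  \<open>card B + card A + j\<close>; the product of these factors is the rising factorial.\<close>

lemma mixed_trace_Un_identity:
  fixes M :: "'i \<Rightarrow> 'b \<Rightarrow> 'b \<Rightarrow> 'c::comm_ring_1"
  assumes "finite S" "finite A" "S \<inter> A = {}" "finite B"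
    and "\<And>i v w. i \<in> S \<Longrightarrow> v \<in> B \<Longrightarrow> w \<in> B \<Longrightarrow> M i v w = of_bool (v = w)"
  shows "mixed_trace (S \<union> A) B M =
    pochhammer (of_nat (card B + card A)) (card S) * mixed_trace A B M"
  using assms(1,3,5)
proof (induction S)
  case (insert x S)
  have "mixed_trace (insert x (S \<union> A)) B M =
      of_nat (card B + card (S \<union> A)) * mixed_trace (S \<union> A) B M"
    by (rule mixed_trace_insert_identity) (use insert assms(2,4) in auto)
  moreover have "card (S \<union> A) = card S + card A"
    using insert assms(2) by (intro card_Un_disjoint) auto
  moreover have "mixed_trace (S \<union> A) B M =
      pochhammer (of_nat (card B + card A)) (card S) * mixed_trace A B M"
    using insert by auto
  ultimately show ?case
    using insert by (simp add: pochhammer_Suc algebra_simps)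
qed simp

text \<open>When all positions carry the same matrix, only the number of positions matters: tuples
  are composed with \<open>f\<close> and permutations are conjugated by it.\<close>

lemma mixed_trace_reindex:
  assumes f: "bij_betw f A A'"
  shows "mixed_trace A' B (\<lambda>_. M) = mixed_trace A B (\<lambda>_. M)"
proof -
  \<comment> \<open>The conjugate of \<open>\<pi>\<close> by \<open>f\<close>, extended by the
    identity outside \<open>A'\<close>, as \<open>permutes\<close> demands.\<close>
  let ?g = "\<lambda>\<pi> x. if x \<in> A' then f (\<pi> (inv_into A f x)) else x"
  have fA: "f i \<in> A'" and inv: "inv_into A f (f i) = i" if "i \<in> A" for i
    using f that by (auto simp: bij_betw_def)
  have invA: "inv_into A f j \<in> A" and finv: "f (inv_into A f j) = j" if "j \<in> A'" for j
    using f that by (auto simp: bij_betw_def inv_into_into f_inv_into_f)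
  have "(\<Sum>a \<in> A' \<rightarrow>\<^sub>E B. \<Prod>i\<in>A'. M (a i) (a (?g \<pi> i))) =
      (\<Sum>a \<in> A \<rightarrow>\<^sub>E B. \<Prod>i\<in>A. M (a i) (a (\<pi> i)))" if \<pi>: "\<pi> permutes A" for \<pi>
  proof (rule sum.reindex_bij_witness[where i = "\<lambda>a. restrict (a \<circ> inv_into A f) A'"
        and j = "\<lambda>a. restrict (a \<circ> f) A"])
    fix a assume "a \<in> A' \<rightarrow>\<^sub>E B"
    have "(\<Prod>i\<in>A'. M (a i) (a (?g \<pi> i))) = (\<Prod>i\<in>A. M (a (f i)) (a (?g \<pi> (f i))))"
      by (rule prod.reindex_bij_betw[OF f, symmetric])
    also have "\<dots> = (\<Prod>i\<in>A. M (restrict (a \<circ> f) A i) (restrict (a \<circ> f) A (\<pi> i)))"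
      by (rule prod.cong) (use \<pi> in \<open>auto simp: fA inv permutes_in_image\<close>)
    finally show "(\<Prod>i\<in>A. M (restrict (a \<circ> f) A i) (restrict (a \<circ> f) A (\<pi> i))) =
        (\<Prod>i\<in>A'. M (a i) (a (?g \<pi> i)))" by simp
  qed (auto simp: fA inv invA finv fun_eq_iff PiE_def Pi_def extensional_def)
  then show ?thesis
    unfolding mixed_trace_def sum.reindex_bij_betw[OF bij_betw_permutations[OF f], symmetric]
    by (intro sum.cong refl) auto
qed

text \<open>Division by \<open>fact r\<close> turns the sum over permutations into the symmetriser,
  so for finite \<open>B\<close> this is the trace of the \<open>r\<close>-th symmetric power of the
  matrix \<open>M\<close>.\<close>

definition sym_trace :: "nat \<Rightarrow> 'b set \<Rightarrow> ('b \<Rightarrow> 'b \<Rightarrow> complex) \<Rightarrow> complex"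
  where "sym_trace r B M = mixed_trace {..<r} B (\<lambda>_. M) / fact r"

lemma mixed_trace_const:
  assumes "finite A"
  shows "mixed_trace A B (\<lambda>_. M) = fact (card A) * sym_trace (card A) B M"
proof -
  obtain f where "bij_betw f {..<card A} A"
    using ex_bij_betw_nat_finite[OF assms] by (auto simp: atLeast0LessThan)
  from mixed_trace_reindex[OF this] show ?thesis
    by (simp add: sym_trace_def)
qed

lemma sym_trace_cong:
  assumes "\<And>v w. v \<in> B \<Longrightarrow> w \<in> B \<Longrightarrow> M v w = N v w"
  shows "sym_trace r B M = sym_trace r B N"
  unfolding sym_trace_def by (subst mixed_trace_cong[where N = "\<lambda>_. N"]) (auto simp: assms)

text \<open>Multiplying out, \<open>S\<close> is the set of positions at which the scalar matrix is
  chosen; these positions are then deleted by \<open>mixed_trace_Un_identity\<close>.\<close>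

lemma mixed_trace_shift:
  fixes M :: "'b \<Rightarrow> 'b \<Rightarrow> 'c::comm_ring_1"
  assumes A: "finite A" and B: "finite B"
  shows "mixed_trace A B (\<lambda>_ v w. M v w + s * of_bool (v = w)) =
    (\<Sum>S\<in>Pow A. s ^ card S * (pochhammer (of_nat (card B + card (A - S))) (card S) *
      mixed_trace (A - S) B (\<lambda>_. M)))"
proof -
  let ?N = "\<lambda>S i v w. if i \<in> S then of_bool (v = w) else M v w"
  have prod: "(\<Prod>i\<in>A. M (a i) (a (\<pi> i)) + s * of_bool (a i = a (\<pi> i))) =
      (\<Sum>S\<in>Pow A. s ^ card S * (\<Prod>i\<in>A. ?N S i (a i) (a (\<pi> i))))" for a \<pi>
  proof -
    \<comment> \<open>The summands are exchanged so that the subset in \<open>prod_add\<close>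
      consists of the positions taking the scalar matrix.\<close>
    have "(\<Prod>i\<in>A. M (a i) (a (\<pi> i)) + s * of_bool (a i = a (\<pi> i))) =
        (\<Prod>i\<in>A. s * of_bool (a i = a (\<pi> i)) + M (a i) (a (\<pi> i)))"
      by (simp add: add.commute)
    also have "\<dots> = (\<Sum>S\<in>Pow A. (\<Prod>i\<in>S. s * of_bool (a i = a (\<pi> i))) * (\<Prod>i\<in>A - S. M (a i) (a (\<pi> i))))"
      by (rule prod_add[OF A])
    also have "\<dots> = (\<Sum>S\<in>Pow A. s ^ card S * (\<Prod>i\<in>A. ?N S i (a i) (a (\<pi> i))))"
    proof (intro sum.cong refl)
      fix S assume S: "S \<in> Pow A"
      then have "(\<Prod>i\<in>A. ?N S i (a i) (a (\<pi> i))) =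
          (\<Prod>i\<in>A - S. ?N S i (a i) (a (\<pi> i))) * (\<Prod>i\<in>S. ?N S i (a i) (a (\<pi> i)))"
        using A by (intro prod.subset_diff) auto
      also have "\<dots> = (\<Prod>i\<in>A - S. M (a i) (a (\<pi> i))) * (\<Prod>i\<in>S. of_bool (a i = a (\<pi> i)))"
        by (intro arg_cong2[where f = "(*)"] prod.cong) auto
      finally show "(\<Prod>i\<in>S. s * of_bool (a i = a (\<pi> i))) * (\<Prod>i\<in>A - S. M (a i) (a (\<pi> i))) =
          s ^ card S * (\<Prod>i\<in>A. ?N S i (a i) (a (\<pi> i)))"
        by (simp only: prod.distrib prod_constant mult_ac)
    qed
    finally show ?thesis .
  qed
  have "mixed_trace A B (\<lambda>_ v w. M v w + s * of_bool (v = w)) =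
      (\<Sum>\<pi> | \<pi> permutes A. \<Sum>S\<in>Pow A. \<Sum>a \<in> A \<rightarrow>\<^sub>E B. s ^ card S * (\<Prod>i\<in>A. ?N S i (a i) (a (\<pi> i))))"
    unfolding mixed_trace_def prod by (intro sum.cong refl sum.swap)
  also have "\<dots> = (\<Sum>S\<in>Pow A. s ^ card S * mixed_trace A B (?N S))"
    unfolding mixed_trace_def sum_distrib_left by (rule sum.swap)
  also have "\<dots> = (\<Sum>S\<in>Pow A. s ^ card S * (pochhammer (of_nat (card B + card (A - S))) (card S) *
      mixed_trace (A - S) B (\<lambda>_. M)))"
  proof (intro sum.cong refl arg_cong2[where f = "(*)"])
    fix S assume S: "S \<in> Pow A"
    then have "mixed_trace A B (?N S) = mixed_trace (S \<union> (A - S)) B (?N S)"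
      by (intro arg_cong[where f = "\<lambda>A. mixed_trace A B _"]) auto
    also have "\<dots> = pochhammer (of_nat (card B + card (A - S))) (card S) * mixed_trace (A - S) B (?N S)"
      by (rule mixed_trace_Un_identity) (use S A B in \<open>auto intro: finite_subset\<close>)
    also have "mixed_trace (A - S) B (?N S) = mixed_trace (A - S) B (\<lambda>_. M)"
      by (rule mixed_trace_cong) auto
    finally show "mixed_trace A B (?N S) =
        pochhammer (of_nat (card B + card (A - S))) (card S) * mixed_trace (A - S) B (\<lambda>_. M)" .
  qed
  finally show ?thesis .
qed

section \<open>Binomial coefficients in the shift formula\<close>

lemma sum_Pow_by_card:
  fixes f :: "nat \<Rightarrow> 'c::comm_semiring_1"
  assumes "finite A"
  shows "(\<Sum>S\<in>Pow A. f (card S)) = (\<Sum>l\<le>card A. of_nat (card A choose l) * f l)"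
proof -
  have "(\<Sum>S\<in>Pow A. f (card S)) = (\<Sum>l\<le>card A. \<Sum>S | S \<in> Pow A \<and> card S = l. f (card S))"
    using assms by (intro sum.group[symmetric]) (auto intro: card_mono)
  also have "\<dots> = (\<Sum>l\<le>card A. of_nat (card A choose l) * f l)"
    using n_subsets[OF assms] by (intro sum.cong refl) simp
  finally show ?thesis .
qed

text \<open>Both sides are the product of the \<open>l\<close> consecutive integers ending at
  \<open>m\<close>.\<close>

lemma pochhammer_eq_fact_binomial:
  assumes "l \<le> m"
  shows "pochhammer (of_nat (m - l) + 1) l = (fact l * of_nat (m choose l) :: complex)"
proof -
  have "of_nat (m choose l) = (of_nat m gchoose l :: complex)"
    by (simp add: binomial_gbinomial)
  also have "\<dots> = pochhammer (of_nat (m - l) + 1) l / fact l"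
    using assms by (simp add: gbinomial_pochhammer' of_nat_diff)
  finally show ?thesis by (simp add: field_simps)
qed

text \<open>The subsets \<open>S\<close> are grouped by their size \<open>l\<close>. The rising
  factorial is \<open>fact l\<close> times a binomial coefficient, and the remaining factorials
  combine with the number of subsets to \<open>fact r\<close>, which cancels the
  normalisation.\<close>

lemma sym_trace_shift:
  assumes B: "finite B" "0 < card B"
  shows "sym_trace r B (\<lambda>v w. M v w + s * of_bool (v = w)) =
    (\<Sum>l\<le>r. of_nat ((card B + r - 1) choose l) * s ^ l * sym_trace (r - l) B M)"
proof -
  let ?A = "{..<r}"
  let ?f = "\<lambda>l. s ^ l * (pochhammer (of_nat (card B + (r - l))) l * (fact (r - l) * sym_trace (r - l) B M))"
  have "mixed_trace ?A B (\<lambda>_ v w. M v w + s * of_bool (v = w)) = (\<Sum>S\<in>Pow ?A. ?f (card S))"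
    unfolding mixed_trace_shift[OF finite_lessThan B(1)]
  proof (intro sum.cong refl)
    fix S assume "S \<in> Pow ?A"
    then have "card (?A - S) = r - card S"
      by (subst card_Diff_subset) (auto intro: finite_subset)
    then show "s ^ card S * (pochhammer (of_nat (card B + card (?A - S))) (card S) *
        mixed_trace (?A - S) B (\<lambda>_. M)) = ?f (card S)"
      by (simp add: mixed_trace_const)
  qed
  also have "\<dots> = (\<Sum>l\<le>r. of_nat (r choose l) * ?f l)"
    using sum_Pow_by_card[of ?A ?f] by simp
  also have "\<dots> = (\<Sum>l\<le>r. fact r * (of_nat ((card B + r - 1) choose l) * s ^ l * sym_trace (r - l) B M))"
  proof (intro sum.cong refl)
    fix l assume "l \<in> {..r}"
    then have l: "l \<le> r" by simp
    \<comment> \<open>Positivity of \<open>card B\<close> keeps the subtraction exact also for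
      \<open>l = r\<close>.\<close>
    have "card B + (r - l) = Suc (card B + r - 1 - l)"
      using l B(2) by simp
    then have "of_nat (card B + (r - l)) = (of_nat (card B + r - 1 - l) + 1 :: complex)"
      by (simp only: of_nat_Suc add.commute)
    then have p: "pochhammer (of_nat (card B + (r - l))) l =
        (fact l * of_nat ((card B + r - 1) choose l) :: complex)"
      using l B(2) by (simp only: pochhammer_eq_fact_binomial)
    have fact: "of_nat (r choose l) * fact l * fact (r - l) = (fact r :: complex)"
      using binomial_fact_lemma[OF l, THEN arg_cong, of "of_nat :: nat \<Rightarrow> complex"]
      by (simp add: mult_ac)
    show "of_nat (r choose l) * ?f l =
        fact r * (of_nat ((card B + r - 1) choose l) * s ^ l * sym_trace (r - l) B M)"
      unfolding p fact[symmetric] by (simp only: mult_ac)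
  qed
  finally show ?thesis
    by (simp add: sym_trace_def[of r B] sum_distrib_left[symmetric])
qed

text \<open>Conjugation invariance of the trace. The factor \<open>Q\<close> at position
  \<open>i\<close> and the factor \<open>P\<close> at position \<open>\<pi> i\<close> share the
  index \<open>x (\<pi> i)\<close>; summing over it gives a Kronecker delta by
  \<open>QP\<close>.\<close>

lemma mixed_trace_conjugate:
  fixes M :: "'b \<Rightarrow> 'b \<Rightarrow> 'c::comm_ring_1"
  assumes fin: "finite A" "finite B" "finite B'"
    and QP: "\<And>v w. v \<in> B \<Longrightarrow> w \<in> B \<Longrightarrow> (\<Sum>b\<in>B'. Q w b * P b v) = of_bool (w = v)"
  shows "mixed_trace A B' (\<lambda>_ x y. \<Sum>v\<in>B. \<Sum>w\<in>B. P x v * M v w * Q w y) = mixed_trace A B (\<lambda>_. M)"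
  unfolding mixed_trace_def
proof (intro sum.cong refl)
  fix \<pi> assume "\<pi> \<in> {\<pi>. \<pi> permutes A}"
  then have \<pi>: "\<pi> permutes A" by simp
  have inv: "inv \<pi> permutes A" by (rule permutes_inv[OF \<pi>])
  have contract: "(\<Sum>x \<in> A \<rightarrow>\<^sub>E B'. \<Prod>i\<in>A. P (x i) (v i) * M (v i) (w i) * Q (w i) (x (\<pi> i))) =
      (\<Prod>i\<in>A. M (v i) (w i) * of_bool (w i = v (\<pi> i)))"
    if v: "v \<in> A \<rightarrow>\<^sub>E B" and w: "w \<in> A \<rightarrow>\<^sub>E B" for v w
  proof -
    have "(\<Prod>i\<in>A. P (x i) (v i) * M (v i) (w i) * Q (w i) (x (\<pi> i))) =
        (\<Prod>i\<in>A. M (v i) (w i)) * (\<Prod>i\<in>A. Q (w (inv \<pi> i)) (x i) * P (x i) (v i))" for x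
    proof -
      \<comment> \<open>Reindexing by the inverse permutation brings together the two factors that
        contain \<open>x i\<close>, so the sum over tuples \<open>x\<close> splits into a product
        over positions.\<close>
      have "(\<Prod>i\<in>A. Q (w i) (x (\<pi> i))) = (\<Prod>i\<in>A. Q (w (inv \<pi> i)) (x i))"
        by (subst prod.permute[OF inv]) (simp add: o_def permutes_inverses[OF \<pi>])
      then show ?thesis by (simp add: prod.distrib mult_ac)
    qed
    then have "(\<Sum>x \<in> A \<rightarrow>\<^sub>E B'. \<Prod>i\<in>A. P (x i) (v i) * M (v i) (w i) * Q (w i) (x (\<pi> i))) =
        (\<Prod>i\<in>A. M (v i) (w i)) * (\<Sum>x \<in> A \<rightarrow>\<^sub>E B'. \<Prod>i\<in>A. Q (w (inv \<pi> i)) (x i) * P (x i) (v i))"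
      by (simp add: sum_distrib_left)
    also have "(\<Sum>x \<in> A \<rightarrow>\<^sub>E B'. \<Prod>i\<in>A. Q (w (inv \<pi> i)) (x i) * P (x i) (v i)) =
        (\<Prod>i\<in>A. \<Sum>b\<in>B'. Q (w (inv \<pi> i)) b * P b (v i))"
      using fin by (intro prod_sum_PiE[symmetric]) auto
    also have "\<dots> = (\<Prod>i\<in>A. of_bool (w (inv \<pi> i) = v i))"
      using v w inv by (intro prod.cong refl QP) (auto simp: permutes_in_image)
    also have "\<dots> = (\<Prod>i\<in>A. of_bool (w i = v (\<pi> i)))"
      by (subst prod.permute[OF \<pi>]) (simp add: o_def permutes_inverses[OF \<pi>])
    finally show ?thesis by (simp only: prod.distrib)
  qed
  have "(\<Sum>x \<in> A \<rightarrow>\<^sub>E B'. \<Prod>i\<in>A. \<Sum>v\<in>B. \<Sum>w\<in>B. P (x i) v * M v w * Q w (x (\<pi> i))) =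
      (\<Sum>x \<in> A \<rightarrow>\<^sub>E B'. \<Sum>v \<in> A \<rightarrow>\<^sub>E B. \<Sum>w \<in> A \<rightarrow>\<^sub>E B.
        \<Prod>i\<in>A. P (x i) (v i) * M (v i) (w i) * Q (w i) (x (\<pi> i)))"
    using fin by (simp add: prod_sum_PiE)
  also have "\<dots> = (\<Sum>v \<in> A \<rightarrow>\<^sub>E B. \<Sum>w \<in> A \<rightarrow>\<^sub>E B. \<Sum>x \<in> A \<rightarrow>\<^sub>E B'.
        \<Prod>i\<in>A. P (x i) (v i) * M (v i) (w i) * Q (w i) (x (\<pi> i)))"
    by (subst sum.swap) (intro sum.cong refl sum.swap)
  also have "\<dots> = (\<Sum>v \<in> A \<rightarrow>\<^sub>E B. \<Sum>w \<in> A \<rightarrow>\<^sub>E B. \<Prod>i\<in>A. M (v i) (w i) * of_bool (w i = v (\<pi> i)))"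
    by (intro sum.cong refl contract)
  also have "\<dots> = (\<Sum>v \<in> A \<rightarrow>\<^sub>E B. \<Prod>i\<in>A. \<Sum>w\<in>B. M (v i) w * of_bool (w = v (\<pi> i)))"
    using fin by (subst prod_sum_PiE) auto
  also have "\<dots> = (\<Sum>v \<in> A \<rightarrow>\<^sub>E B. \<Prod>i\<in>A. M (v i) (v (\<pi> i)))"
  proof (intro sum.cong prod.cong refl)
    fix v i assume "v \<in> A \<rightarrow>\<^sub>E B" "i \<in> A"
    then have "v (\<pi> i) \<in> B" using \<pi> by (auto simp: permutes_in_image)
    then show "(\<Sum>w\<in>B. M (v i) w * of_bool (w = v (\<pi> i))) = M (v i) (v (\<pi> i))"
      using fin by (simp add: of_bool_def if_distrib cong: if_cong)
  qed
  finally show "(\<Sum>x \<in> A \<rightarrow>\<^sub>E B'. \<Prod>i\<in>A. \<Sum>v\<in>B. \<Sum>w\<in>B. P (x i) v * M v w * Q w (x (\<pi> i))) = \<dots>" .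
qed

subsection \<open>The sections in a basis of the fibre\<close>

lemma GrassD:
  assumes "W \<in> Grass k"
  shows "vec.subspace W" "finite (some_basis W)" "card (some_basis W) = k"
proof -
  show W: "vec.subspace W" using assms by (simp add: Grass_def)
  note B = some_basis[OF W]
  show "finite (some_basis W)" using B(2) by (rule vec.finiteI_independent)
  have "vec.dim (vec.span (some_basis W)) = card (some_basis W)"
    by (rule vec.dim_span_eq_card_independent[OF B(2)])
  then show "card (some_basis W) = k" using assms B(3) by (simp add: Grass_def)
qed

section \<open>Endomorphisms and functionals as matrices\<close>

lemma dyad_End:
  fixes \<B> :: "(complex^'n) set"
  assumes "vec.independent \<B>" "v \<in> vec.span \<B>"
  shows "dyad \<B> v w \<in> End (vec.span \<B>)"
proof -
  have "vec.representation \<B> x w = 0" if "x \<notin> vec.span \<B>" for x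
    using that by (simp add: vec.representation_def)
  with assms show ?thesis
    by (simp add: End_def lin_maps_def dyad_def vec.representation_add vec.representation_scale
        vec.scale_left_distrib vec.span_scale)
qed

lemma zero_End:
  assumes "vec.subspace W"
  shows "0 \<in> End W"
  using assms by (simp add: End_def lin_maps_def vec.subspace_0)

lemma sum_End:
  assumes "vec.subspace W" "\<And>j. j \<in> J \<Longrightarrow> e j \<in> End W"
  shows "sum e J \<in> End W"
  using assms(2) by (induction J rule: infinite_finite_induct) (simp_all add: End_add zero_End assms(1))

text \<open>Linearity of \<open>\<xi>\<close> is available only on \<open>End W\<close>, so the
  induction also has to keep the partial sums in that space.\<close>

lemma dual_end_sum:
  assumes W: "vec.subspace W" and \<xi>: "\<xi> \<in> dual_end W" and e: "\<And>j. j \<in> J \<Longrightarrow> e j \<in> End W"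
  shows "\<xi> (\<Sum>j\<in>J. scale_end (c j) (e j)) = (\<Sum>j\<in>J. c j * \<xi> (e j))"
proof -
  \<comment> \<open>The value at zero is read off from homogeneity with scalar 0.\<close>
  have "\<xi> (scale_end 0 0) = 0"
    using \<xi> zero_End[OF W] by (simp add: dual_end_def lin_maps_def)
  then have zero: "\<xi> 0 = 0" by (simp add: scale_end_def zero_fun_def)
  from e show ?thesis
  proof (induction J rule: infinite_finite_induct)
    case (insert j J)
    then have "scale_end (c j) (e j) \<in> End W" "(\<Sum>j\<in>J. scale_end (c j) (e j)) \<in> End W"
      using W by (auto intro!: End_scale sum_End)
    with \<xi> have "\<xi> (scale_end (c j) (e j) + (\<Sum>j\<in>J. scale_end (c j) (e j))) =
        \<xi> (scale_end (c j) (e j)) + \<xi> (\<Sum>j\<in>J. scale_end (c j) (e j))"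
      by (simp only: dual_end_def lin_maps_def mem_Collect_eq)
    moreover have "\<xi> (scale_end (c j) (e j)) = c j * \<xi> (e j)"
      using \<xi> insert.prems by (simp add: dual_end_def lin_maps_def)
    ultimately show ?case
      using insert by (simp only: sum.insert insert_iff simp_thms)
  qed (simp_all only: sum.infinite sum.empty zero simp_thms)
qed

lemma sum_fun_apply: "(\<Sum>j\<in>J. f j) x = (\<Sum>j\<in>J. f j x)"
  by (induction J rule: infinite_finite_induct) simp_all

lemma power_fun_apply: "(f ^ m) x = f x ^ m"
  by (induction m) simp_all

text \<open>The dyads are the elementary matrices of the basis, and the coefficient is the entry of
  \<open>\<sigma>\<close> in row \<open>v\<close> and column \<open>w\<close>. Outside
  \<open>W\<close> both sides vanish, by the extension by zero and the convention for
  \<open>vec.representation\<close>.\<close>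

lemma End_expand:
  fixes \<B> :: "(complex^'n) set"
  assumes \<B>: "vec.independent \<B>" "vec.span \<B> = W" and \<sigma>: "\<sigma> \<in> End W"
  shows "\<sigma> = (\<Sum>(v, w)\<in>\<B> \<times> \<B>. scale_end (vec.representation \<B> (\<sigma> w) v) (dyad \<B> v w))"
proof
  fix x
  have fin: "finite \<B>" by (rule vec.finiteI_independent[OF \<B>(1)])
  note rep = vec.sum_representation_eq[OF \<B>(1) _ fin subset_refl, unfolded \<B>(2)]
  have W: "vec.subspace W" using \<B>(2) by auto
  have \<B>W: "b \<in> W" if "b \<in> \<B>" for b using that \<B>(2) vec.span_base by auto
  have \<sigma>_sum: "\<sigma> (\<Sum>b\<in>F. c b *s b) = (\<Sum>b\<in>F. c b *s \<sigma> b)" if "F \<subseteq> \<B>" for F c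
  proof -
    from that fin have "finite F" by (rule finite_subset)
    from this that show ?thesis
    proof (induction F)
      case empty
      have "\<sigma> (0 *s 0) = 0 *s \<sigma> 0"
        using \<sigma> W by (simp only: End_def lin_maps_def mem_Collect_eq vec.subspace_0)
      then show ?case by simp
    next
      case (insert b F)
      then have "c b *s b \<in> W" "(\<Sum>b\<in>F. c b *s b) \<in> W"
        using W \<B>W by (auto intro!: vec.subspace_scale vec.subspace_sum)
      with insert \<sigma> \<B>W show ?case by (simp add: End_def lin_maps_def)
    qed
  qed
  have "(\<Sum>(v, w)\<in>\<B> \<times> \<B>. scale_end (vec.representation \<B> (\<sigma> w) v) (dyad \<B> v w)) x =
      (\<Sum>w\<in>\<B>. \<Sum>v\<in>\<B>. vec.representation \<B> (\<sigma> w) v *s (vec.representation \<B> x w *s v))"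
    by (subst sum.swap)
       (simp add: sum_fun_apply sum.cartesian_product case_prod_unfold scale_end_def dyad_def)
  also have "\<dots> = (\<Sum>w\<in>\<B>. vec.representation \<B> x w *s (\<Sum>v\<in>\<B>. vec.representation \<B> (\<sigma> w) v *s v))"
    by (simp add: vec.scale_sum_right vec.scale_left_commute mult_ac)
  also have "\<dots> = (\<Sum>w\<in>\<B>. vec.representation \<B> x w *s \<sigma> w)"
    using \<sigma> \<B>W by (intro sum.cong refl) (simp add: rep End_def lin_maps_def)
  also have "\<dots> = \<sigma> x"
  proof (cases "x \<in> W")
    case True
    then show ?thesis by (simp add: \<sigma>_sum[OF subset_refl, symmetric] rep)
  next
    case False
    then show ?thesis using \<sigma> \<B>(2) by (simp add: End_def lin_maps_def vec.representation_def)
  qed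
  finally show "\<sigma> x = (\<Sum>(v, w)\<in>\<B> \<times> \<B>. scale_end (vec.representation \<B> (\<sigma> w) v) (dyad \<B> v w)) x" ..
qed

text \<open>This makes \<open>\<xi>\<close> a matrix with entries
  \<open>\<xi> (dyad \<B> v w)\<close>, paired entrywise with the matrix of
  \<open>\<sigma>\<close>.\<close>

lemma dual_end_expand:
  fixes \<B> :: "(complex^'n) set"
  assumes \<B>: "vec.independent \<B>" "vec.span \<B> = W" and \<xi>: "\<xi> \<in> dual_end W" and \<sigma>: "\<sigma> \<in> End W"
  shows "\<xi> \<sigma> = (\<Sum>v\<in>\<B>. \<Sum>w\<in>\<B>. vec.representation \<B> (\<sigma> w) v * \<xi> (dyad \<B> v w))"
proof -
  have W: "vec.subspace W" using \<B>(2) by auto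
  have dyad: "dyad \<B> v w \<in> End W" if "v \<in> \<B>" for v w
    using dyad_End[OF \<B>(1) vec.span_base[OF that]] \<B>(2) by simp
  have "\<xi> \<sigma> = \<xi> (\<Sum>p\<in>\<B> \<times> \<B>. scale_end (vec.representation \<B> (\<sigma> (snd p)) (fst p)) (dyad \<B> (fst p) (snd p)))"
    using End_expand[OF \<B> \<sigma>] by (simp add: case_prod_unfold)
  also have "\<dots> = (\<Sum>p\<in>\<B> \<times> \<B>. vec.representation \<B> (\<sigma> (snd p)) (fst p) * \<xi> (dyad \<B> (fst p) (snd p)))"
    by (rule dual_end_sum[OF W \<xi>]) (auto intro: dyad)
  finally show ?thesis by (simp add: sum.cartesian_product case_prod_unfold)
qed

lemma dual_end_id_end:
  fixes \<B> :: "(complex^'n) set"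
  assumes \<B>: "vec.independent \<B>" "vec.span \<B> = W" and \<xi>: "\<xi> \<in> dual_end W"
  shows "\<xi> (id_end W) = (\<Sum>v\<in>\<B>. \<xi> (dyad \<B> v v))"
proof -
  have W: "vec.subspace W" using \<B>(2) by auto
  have fin: "finite \<B>" by (rule vec.finiteI_independent[OF \<B>(1)])
  have "\<xi> (id_end W) = (\<Sum>v\<in>\<B>. \<Sum>w\<in>\<B>. if v = w then \<xi> (dyad \<B> v w) else 0)"
    unfolding dual_end_expand[OF \<B> \<xi> id_end_End[OF W]]
    using \<B> vec.span_base[of _ \<B>]
    by (intro sum.cong refl) (auto simp: id_end_def vec.representation_basis)
  then show ?thesis using fin by simp
qed

text \<open>For each \<open>\<pi>\<close> the deltas in the component force
  \<open>b i = a (\<pi> i)\<close>, so the sum over \<open>b\<close> collapses to a single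
  tuple.\<close>

lemma kappa_eq_sym_trace:
  fixes W :: "(complex^'n::finite) set"
  assumes W: "W \<in> Grass k" and \<xi>: "\<xi> \<in> dual_end W"
  shows "kappa k r W \<xi> = sym_trace r (some_basis W) (\<lambda>v w. \<xi> (dyad (some_basis W) v w))"
proof -
  let ?B = "some_basis W" and ?A = "{..<r}"
  let ?M = "\<lambda>v w. \<xi> (dyad ?B v w)"
  let ?\<delta> = "\<lambda>v w. if v = w then 1 else 0 :: complex"
  note fin = GrassD(2)[OF W]
  have "kappa k r W \<xi> = (\<Sum>a \<in> ?A \<rightarrow>\<^sub>E ?B. \<Sum>b \<in> ?A \<rightarrow>\<^sub>E ?B.
      1 / fact r * (\<Sum>\<pi> | \<pi> permutes ?A. \<Prod>i<r. ?\<delta> (a (\<pi> i)) (b i)) * (\<Prod>i<r. ?M (a i) (b i)))"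
    using W \<xi> by (simp add: kappa_def sym_prod_def kappa_component_def Let_def)
  also have "\<dots> = (\<Sum>a \<in> ?A \<rightarrow>\<^sub>E ?B. \<Sum>b \<in> ?A \<rightarrow>\<^sub>E ?B. \<Sum>\<pi> | \<pi> permutes ?A.
      (\<Prod>i<r. ?\<delta> (a (\<pi> i)) (b i) * ?M (a i) (b i))) / fact r"
    by (simp add: sum_divide_distrib sum_distrib_right prod.distrib)
  also have "(\<Sum>a \<in> ?A \<rightarrow>\<^sub>E ?B. \<Sum>b \<in> ?A \<rightarrow>\<^sub>E ?B. \<Sum>\<pi> | \<pi> permutes ?A.
      (\<Prod>i<r. ?\<delta> (a (\<pi> i)) (b i) * ?M (a i) (b i))) =
      (\<Sum>a \<in> ?A \<rightarrow>\<^sub>E ?B. \<Sum>\<pi> | \<pi> permutes ?A. \<Sum>b \<in> ?A \<rightarrow>\<^sub>E ?B.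
      (\<Prod>i<r. ?\<delta> (a (\<pi> i)) (b i) * ?M (a i) (b i)))"
    by (intro sum.cong refl sum.swap)
  also have "\<dots> = (\<Sum>a \<in> ?A \<rightarrow>\<^sub>E ?B. \<Sum>\<pi> | \<pi> permutes ?A. \<Prod>i<r. ?M (a i) (a (\<pi> i)))"
  proof (intro sum.cong refl)
    fix a \<pi> assume a: "a \<in> ?A \<rightarrow>\<^sub>E ?B" and \<pi>: "\<pi> \<in> {\<pi>. \<pi> permutes ?A}"
    have "(\<Sum>b \<in> ?A \<rightarrow>\<^sub>E ?B. \<Prod>i<r. ?\<delta> (a (\<pi> i)) (b i) * ?M (a i) (b i)) =
        (\<Prod>i<r. \<Sum>b\<in>?B. ?\<delta> (a (\<pi> i)) b * ?M (a i) b)"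
      using fin by (subst prod_sum_PiE) auto
    also have "\<dots> = (\<Prod>i<r. ?M (a i) (a (\<pi> i)))"
    proof (intro prod.cong refl)
      fix i assume "i \<in> ?A"
      moreover have "\<pi> i \<in> ?A" using \<pi> \<open>i \<in> ?A\<close> by (simp only: permutes_in_image mem_Collect_eq)
      ultimately have "a (\<pi> i) \<in> ?B" using a by auto
      then show "(\<Sum>b\<in>?B. ?\<delta> (a (\<pi> i)) b * ?M (a i) b) = ?M (a i) (a (\<pi> i))"
        using fin by (simp add: if_distrib[of "\<lambda>x. x * _"] cong: if_cong)
    qed
    finally show "(\<Sum>b \<in> ?A \<rightarrow>\<^sub>E ?B. \<Prod>i<r. ?\<delta> (a (\<pi> i)) (b i) * ?M (a i) (b i)) = \<dots>" .
  qed
  also have "\<dots> = mixed_trace ?A ?B (\<lambda>_. ?M)"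
    unfolding mixed_trace_def by (rule sum.swap)
  finally show ?thesis by (simp add: sym_trace_def)
qed

lemma kappa_outside: "W \<notin> Grass k \<Longrightarrow> kappa k r W = 0"
  by (simp add: kappa_def)

text \<open>This includes \<open>r = 0\<close>, because \<open>sym_prod\<close> cuts off the empty
  product as well.\<close>

lemma kappa_outside_dual: "\<xi> \<notin> dual_end W \<Longrightarrow> kappa k r W \<xi> = 0"
  by (simp add: kappa_def sym_prod_def)

lemma sym_trace_1: "sym_trace 1 B M = (\<Sum>v\<in>B. M v v)"
proof -
  have "{..<1::nat} = insert 0 {}" by auto
  then show ?thesis
    by (simp add: sym_trace_def mixed_trace_def sum_PiE_insert)
qed

text \<open>Both sides are the trace of the matrix of \<open>\<xi>\<close>.\<close>

lemma kappa_1: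
  fixes W :: "(complex^'n::finite) set"
  assumes W: "W \<in> Grass k" and \<xi>: "\<xi> \<in> dual_end W"
  shows "kappa k 1 W \<xi> = \<xi> (id_end W)"
  unfolding kappa_eq_sym_trace[OF assms] sym_trace_1
  using some_basis[OF GrassD(1)[OF W]] \<xi> by (simp add: dual_end_id_end)

section \<open>The effect of \<open>h\<close> on the matrix of a functional\<close>

lemma tr_end_dyad:
  assumes W: "vec.subspace W" and "v \<in> some_basis W" "w \<in> some_basis W"
  shows "tr_end W (dyad (some_basis W) v w) = of_bool (v = w)"
proof -
  note B = some_basis[OF W]
  have "tr_end W (dyad (some_basis W) v w) =
      (\<Sum>u\<in>some_basis W. if u = w then of_bool (v = w) else 0)"
    unfolding tr_end_def Let_def using assms(2,3) B
    by (intro sum.cong refl)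
       (auto simp: dyad_def vec.representation_basis vec.representation_scale vec.span_base vec.representation_zero)
  then show ?thesis
    using assms(3) vec.finiteI_independent[OF B(2)] by simp
qed

text \<open>An elementary matrix has trace 1 on the diagonal and 0 off it, so the transpose of
  \<open>h\<close> adds a scalar matrix to the matrix of \<open>\<xi>\<close>.\<close>

lemma transpose_h_end_dyad:
  fixes W :: "(complex^'n::finite) set"
  assumes W: "vec.subspace W" and \<xi>: "\<xi> \<in> dual_end W"
    and vw: "v \<in> some_basis W" "w \<in> some_basis W"
  shows "transpose_end W (h_end \<epsilon> W) \<xi> (dyad (some_basis W) v w) =
    \<xi> (dyad (some_basis W) v w) + \<epsilon> * \<xi> (id_end W) * of_bool (v = w)"
proof -
  let ?D = "dyad (some_basis W) v w"
  have D: "?D \<in> End W"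
    using dyad_End[OF some_basis(2)[OF W]] vw some_basis[OF W] by (simp add: subset_iff)
  have "\<xi> (?D + scale_end c (id_end W)) = \<xi> ?D + c * \<xi> (id_end W)" for c
    using \<xi> D End_scale[OF W id_end_End[OF W]] id_end_End[OF W] by (simp add: dual_end_def lin_maps_def)
  with D show ?thesis
    by (simp add: transpose_end_def h_end_def tr_end_dyad[OF W vw])
qed

text \<open>The shift formula with \<open>s\<close> equal to \<open>\<epsilon>\<close> times
  \<open>\<kappa>\<^sub>1\<close>. It yields both the invariance of the section and, after splitting
  the binomial coefficient, the expansion sought.\<close>

lemma h_section_kappa:
  fixes W :: "(complex^'n::finite) set"
  assumes W: "W \<in> Grass k" and \<xi>: "\<xi> \<in> dual_end W" and "0 < k"
  shows "h_section \<epsilon> k (kappa k r) W \<xi> =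
    (\<Sum>l\<le>r. of_nat ((k + r - 1) choose l) * (\<epsilon> * kappa k 1 W \<xi>) ^ l * kappa k (r - l) W \<xi>)"
proof -
  note sub = GrassD(1)[OF W]
  have \<xi>': "transpose_end W (h_end \<epsilon> W) \<xi> \<in> dual_end W"
    by (rule transpose_end_dual[OF \<xi> sub h_end_linear[OF sub]])
  have "h_section \<epsilon> k (kappa k r) W \<xi> = kappa k r W (transpose_end W (h_end \<epsilon> W) \<xi>)"
    using W \<xi> by (simp add: h_section_def sym_map_def)
  also have "\<dots> = sym_trace r (some_basis W)
      (\<lambda>v w. \<xi> (dyad (some_basis W) v w) + \<epsilon> * kappa k 1 W \<xi> * of_bool (v = w))"
    unfolding kappa_eq_sym_trace[OF W \<xi>'] kappa_1[OF W \<xi>]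
    by (intro sym_trace_cong transpose_h_end_dyad sub \<xi>)
  also have "\<dots> = (\<Sum>l\<le>r. of_nat ((k + r - 1) choose l) * (\<epsilon> * kappa k 1 W \<xi>) ^ l * kappa k (r - l) W \<xi>)"
    using sym_trace_shift[of "some_basis W" r] GrassD[OF W] assms(3)
    by (simp add: kappa_eq_sym_trace[OF W \<xi>])
  finally show ?thesis .
qed

subsection \<open>Invariance under the general linear group\<close>

lemma matrix_inv_vector:
  fixes g :: "complex^'n^'n"
  assumes "invertible g"
  shows "matrix_inv g *v (g *v x) = x" "g *v (matrix_inv g *v x) = x"
proof -
  have "g ** matrix_inv g = mat 1 \<and> matrix_inv g ** g = mat 1"
    using assms unfolding invertible_def matrix_inv_def by (rule someI_ex)
  then show "matrix_inv g *v (g *v x) = x" "g *v (matrix_inv g *v x) = x"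
    by (simp_all add: matrix_vector_mul_assoc)
qed

lemma translate_Grass:
  fixes g :: "complex^'n^'n"
  assumes g: "invertible g" and W: "W \<in> Grass k"
  shows "translate g W \<in> Grass k"
proof -
  have "inj ((*v) g)"
    by (rule inj_on_inverseI) (rule matrix_inv_vector(1)[OF g])
  then have "vec.dim ((*v) g ` W) = vec.dim W"
    by (intro vec.dim_image_eq matrix_vector_mul_linear_gen) (auto intro: inj_on_subset)
  then show ?thesis
    using W by (simp add: Grass_def translate_def vec.linear_subspace_image[OF matrix_vector_mul_linear_gen])
qed

text \<open>The argument of \<open>\<xi>\<close> inside \<open>push_dual\<close>, named so that its
  linearity in \<open>\<tau>\<close> can be stated.\<close>

definition conj_end ::
    "complex^'n^'n \<Rightarrow> (complex^'n) set \<Rightarrow> (complex^'n \<Rightarrow> complex^'n) \<Rightarrow> complex^'n \<Rightarrow> complex^'n"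
  where "conj_end g W \<tau> = (\<lambda>x. if x \<in> W then matrix_inv g *v \<tau> (g *v x) else 0)"

lemma conj_end_End:
  fixes g :: "complex^'n^'n"
  assumes g: "invertible g" and W: "vec.subspace W" and \<tau>: "\<tau> \<in> End (translate g W)"
  shows "conj_end g W \<tau> \<in> End W"
proof -
  have gW: "g *v x \<in> translate g W" if "x \<in> W" for x
    using that by (simp add: translate_def)
  have inv: "matrix_inv g *v y \<in> W" if "y \<in> translate g W" for y
    using that by (auto simp: translate_def matrix_inv_vector[OF g])
  show ?thesis
    using \<tau> W gW inv
    by (simp add: End_def lin_maps_def conj_end_def vec.subspace_add vec.subspace_scale
        matrix_vector_right_distrib vector_scalar_commute)
qed

lemma push_dual_in_dual_end:
  fixes g :: "complex^'n^'n"
  assumes g: "invertible g" and W: "W \<in> Grass k" and \<xi>: "\<xi> \<in> dual_end W"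
  shows "push_dual g W \<xi> \<in> dual_end (translate g W)"
proof -
  note sub = GrassD(1)[OF W] and sub' = GrassD(1)[OF translate_Grass[OF g W]]
  have push: "push_dual g W \<xi> \<tau> = \<xi> (conj_end g W \<tau>)" if "\<tau> \<in> End (translate g W)" for \<tau>
    using that by (simp add: push_dual_def conj_end_def)
  have outside: "push_dual g W \<xi> \<tau> = 0" if "\<tau> \<notin> End (translate g W)" for \<tau>
    using that by (simp add: push_dual_def)
  have add: "conj_end g W (\<sigma> + \<tau>) = conj_end g W \<sigma> + conj_end g W \<tau>" for \<sigma> \<tau>
    by (simp add: conj_end_def fun_eq_iff matrix_vector_right_distrib)
  have scale: "conj_end g W (scale_end c \<tau>) = scale_end c (conj_end g W \<tau>)" for c \<tau>
    by (simp add: conj_end_def scale_end_def fun_eq_iff vector_scalar_commute)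
  have "push_dual g W \<xi> (\<sigma> + \<tau>) = push_dual g W \<xi> \<sigma> + push_dual g W \<xi> \<tau>"
    if "\<sigma> \<in> End (translate g W)" "\<tau> \<in> End (translate g W)" for \<sigma> \<tau>
    unfolding push[OF that(1)] push[OF that(2)] push[OF End_add[OF sub' that]] add
    using \<xi> that[THEN conj_end_End[OF g sub]] by (simp only: dual_end_def lin_maps_def mem_Collect_eq)
  moreover have "push_dual g W \<xi> (scale_end c \<tau>) = c * push_dual g W \<xi> \<tau>"
    if "\<tau> \<in> End (translate g W)" for c \<tau>
    unfolding push[OF that] push[OF End_scale[OF sub' that]] scale
    using \<xi> that[THEN conj_end_End[OF g sub]] by (simp only: dual_end_def lin_maps_def mem_Collect_eq)
  ultimately show ?thesis
    unfolding dual_end_def lin_maps_def by (simp add: outside)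
qed

text \<open>The basis chosen in the translate need not be the image of the one chosen in
  \<open>W\<close>. The two matrices of the functional therefore differ by a change of basis, which
  \<open>mixed_trace_conjugate\<close> removes.\<close>

lemma kappa_invariant:
  fixes g :: "complex^'n::finite^'n"
  assumes g: "invertible g" and W: "W \<in> Grass k" and \<xi>: "\<xi> \<in> dual_end W"
  shows "kappa k r (translate g W) (push_dual g W \<xi>) = kappa k r W \<xi>"
proof -
  let ?W' = "translate g W"
  define B where "B = some_basis W"
  define B' where "B' = some_basis ?W'"
  have W': "?W' \<in> Grass k" by (rule translate_Grass[OF g W])
  note sub = GrassD(1)[OF W] and sub' = GrassD(1)[OF W']
  note bas = some_basis[OF sub, folded B_def] and bas' = some_basis[OF sub', folded B'_def]
  have fin: "finite B" "finite B'"
    using GrassD(2)[OF W] GrassD(2)[OF W'] by (simp_all add: B_def B'_def)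
  \<comment> \<open>\<open>P\<close> is the matrix of the inverse of \<open>g\<close> and
    \<open>Q\<close> that of \<open>g\<close>, each with respect to the two chosen bases.\<close>
  define P where "P x v = vec.representation B (matrix_inv g *v x) v" for x v
  define Q where "Q w y = vec.representation B' (g *v w) y" for w y
  have gB: "g *v w \<in> vec.span B'" if "w \<in> B" for w
    using that bas(1) bas'(3) by (auto simp: translate_def)
  have inv: "matrix_inv g *v x \<in> vec.span B" if "x \<in> B'" for x
    using that bas'(1) bas(3) by (auto simp: translate_def matrix_inv_vector[OF g])
  have dyad: "dyad B' x y \<in> End ?W'" if "x \<in> B'" for x y
    using dyad_End[OF bas'(2) vec.span_base[OF that]] bas'(3) by simp
  have "push_dual g W \<xi> (dyad B' x y) = (\<Sum>v\<in>B. \<Sum>w\<in>B. P x v * \<xi> (dyad B v w) * Q w y)"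
    if "x \<in> B'" "y \<in> B'" for x y
  proof -
    have "push_dual g W \<xi> (dyad B' x y) = \<xi> (conj_end g W (dyad B' x y))"
      using dyad[OF that(1)] by (simp add: push_dual_def conj_end_def)
    also have "\<dots> = (\<Sum>v\<in>B. \<Sum>w\<in>B.
        vec.representation B (conj_end g W (dyad B' x y) w) v * \<xi> (dyad B v w))"
      by (rule dual_end_expand[OF bas(2,3) \<xi> conj_end_End[OF g sub dyad[OF that(1)]]])
    also have "\<dots> = (\<Sum>v\<in>B. \<Sum>w\<in>B. P x v * \<xi> (dyad B v w) * Q w y)"
    proof (intro sum.cong refl)
      fix v w assume "w \<in> B"
      then have "conj_end g W (dyad B' x y) w = Q w y *s (matrix_inv g *v x)"
        using bas(1) by (auto simp: conj_end_def dyad_def Q_def vector_scalar_commute)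
      then have "vec.representation B (conj_end g W (dyad B' x y) w) v = Q w y * P x v"
        by (simp add: P_def vec.representation_scale[OF bas(2) inv[OF that(1)]])
      then show "vec.representation B (conj_end g W (dyad B' x y) w) v * \<xi> (dyad B v w) =
          P x v * \<xi> (dyad B v w) * Q w y" by simp
    qed
    finally show ?thesis .
  qed
  then have "sym_trace r B' (\<lambda>x y. push_dual g W \<xi> (dyad B' x y)) =
      sym_trace r B' (\<lambda>x y. \<Sum>v\<in>B. \<Sum>w\<in>B. P x v * \<xi> (dyad B v w) * Q w y)"
    by (rule sym_trace_cong)
  also have "\<dots> = sym_trace r B (\<lambda>v w. \<xi> (dyad B v w))"
    unfolding sym_trace_def
  proof (subst mixed_trace_conjugate[OF finite_lessThan fin])
    fix v w assume "v \<in> B" "w \<in> B"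
    \<comment> \<open>Expanding \<open>g *v w\<close> in \<open>B'\<close> and applying the inverse
      of \<open>g\<close> termwise returns \<open>w\<close>, whose coordinates are Kronecker
      deltas.\<close>
    have "(\<Sum>b\<in>B'. Q w b * P b v) =
        vec.representation B (\<Sum>b\<in>B'. Q w b *s (matrix_inv g *v b)) v"
      using bas(2) inv
      by (subst vec.representation_sum)
         (auto simp: P_def vec.representation_scale vec.span_scale)
    also have "(\<Sum>b\<in>B'. Q w b *s (matrix_inv g *v b)) = matrix_inv g *v (\<Sum>b\<in>B'. Q w b *s b)"
      by (simp add: vec.linear_sum[OF matrix_vector_mul_linear_gen] vector_scalar_commute)
    also have "(\<Sum>b\<in>B'. Q w b *s b) = g *v w"
      unfolding Q_def by (rule vec.sum_representation_eq[OF bas'(2) gB[OF \<open>w \<in> B\<close>] fin(2) subset_refl])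
    finally show "(\<Sum>b\<in>B'. Q w b * P b v) = of_bool (w = v)"
      using \<open>w \<in> B\<close> bas(2) by (auto simp: matrix_inv_vector[OF g] vec.representation_basis)
  qed simp
  finally show ?thesis
    by (simp add: kappa_eq_sym_trace[OF W \<xi>] kappa_eq_sym_trace[OF W' push_dual_in_dual_end[OF g W \<xi>]]
        B_def B'_def)
qed

subsection \<open>Holomorphy and polynomiality\<close>

lemma open_invertible: "open {g :: complex^'n^'n. invertible g}"
proof -
  have "continuous_on UNIV (det :: complex^'n^'n \<Rightarrow> complex)"
    unfolding det_def by (intro continuous_intros)
  then show ?thesis
    unfolding invertible_det_nz by (intro open_Collect_neq continuous_on_const) auto
qed

text \<open>The pullback is constant on the invertible matrices. Since they form an open set, its
  derivative there is zero, which is complex linear, whatever the values at singular matrices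
  are.\<close>

lemma invariant_holomorphic_section:
  fixes s :: "'n::finite sym_section"
  assumes "\<And>g W \<xi>. invertible g \<Longrightarrow> W \<in> Grass k \<Longrightarrow> \<xi> \<in> dual_end W \<Longrightarrow>
    s (translate g W) (push_dual g W \<xi>) = s W \<xi>"
  shows "holomorphic_section k s"
  unfolding holomorphic_section_def complex_differentiable_at_def
proof (intro ballI allI impI exI conjI)
  fix W :: "(complex^'n) set" and \<xi> and g :: "complex^'n^'n"
  assume W: "W \<in> Grass k" and \<xi>: "\<xi> \<in> dual_end W" and g: "invertible g"
  show "((\<lambda>g. s (translate g W) (push_dual g W \<xi>)) has_derivative (\<lambda>_. 0)) (at g)"
  proof (rule has_derivative_transform_within_open[OF has_derivative_const open_invertible])
    show "g \<in> {g. invertible g}" using g by simp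
    show "s W \<xi> = s (translate g' W) (push_dual g' W \<xi>)" if "g' \<in> {g. invertible g}" for g'
      using assms[of g' W \<xi>] that W \<xi> by simp
  qed
qed simp

text \<open>Allows any finite index set in place of the initial segments of the naturals in
  \<open>Sym_end\<close>.\<close>

lemma Sym_end_sum:
  assumes J: "finite J" and e: "\<And>j i. j \<in> J \<Longrightarrow> i < r \<Longrightarrow> e j i \<in> End W"
  shows "(\<lambda>\<xi>. \<Sum>j\<in>J. c j * sym_prod W r (e j) \<xi>) \<in> Sym_end r W"
proof -
  obtain f where f: "bij_betw f {..<card J} J"
    using ex_bij_betw_nat_finite[OF J] by (auto simp: atLeast0LessThan)
  have "(\<Sum>j\<in>J. c j * sym_prod W r (e j) \<xi>) = (\<Sum>j<card J. c (f j) * sym_prod W r (e (f j)) \<xi>)" for \<xi>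
    by (rule sum.reindex_bij_betw[OF f, symmetric])
  moreover have "\<forall>j<card J. \<forall>i<r. e (f j) i \<in> End W"
    using e f by (auto simp: bij_betw_def)
  ultimately show ?thesis
    unfolding Sym_end_def by (intro CollectI exI[of _ "card J"] exI[of _ "\<lambda>j. c (f j)"] exI[of _ "\<lambda>j. e (f j)"]) auto
qed

lemma kappa_Sym_end:
  fixes W :: "(complex^'n::finite) set"
  assumes W: "W \<in> Grass k"
  shows "kappa k r W \<in> Sym_end r W"
proof -
  let ?B = "some_basis W"
  note sub = GrassD(1)[OF W]
  have "kappa k r W = (\<lambda>\<xi>. \<Sum>p \<in> ({..<r} \<rightarrow>\<^sub>E ?B) \<times> ({..<r} \<rightarrow>\<^sub>E ?B).
      kappa_component r (fst p) (snd p) * sym_prod W r (\<lambda>i. dyad ?B (fst p i) (snd p i)) \<xi>)"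
    using W by (simp add: kappa_def Let_def sum.cartesian_product case_prod_unfold)
  also have "\<dots> \<in> Sym_end r W"
  proof (rule Sym_end_sum)
    fix p i assume "p \<in> ({..<r} \<rightarrow>\<^sub>E ?B) \<times> ({..<r} \<rightarrow>\<^sub>E ?B)" "i < r"
    then have "fst p i \<in> ?B" by (intro PiE_mem[of "fst p" "{..<r}" "\<lambda>_. ?B"]) (simp_all add: mem_Times_iff)
    then show "dyad ?B (fst p i) (snd p i) \<in> End W"
      using dyad_End[OF some_basis(2)[OF sub]] some_basis[OF sub] by (simp add: subset_iff)
  qed (use GrassD(2)[OF W] in \<open>auto intro: finite_PiE\<close>)
  finally show ?thesis .
qed

lemma sym_map_Sym_end:
  assumes W: "vec.subspace W" and L: "L \<in> lin_maps scale_end (End W) scale_end (End W)"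
    and f: "f \<in> Sym_end r W"
  shows "sym_map W L f \<in> Sym_end r W"
proof -
  obtain N :: nat and c e where f: "f = (\<lambda>\<xi>. \<Sum>j<N. c j * sym_prod W r (e j) \<xi>)"
    and e: "\<forall>j<N. \<forall>i<r. e j i \<in> End W"
    using f unfolding Sym_end_def by blast
  have "sym_map W L f = (\<lambda>\<xi>. \<Sum>j<N. c j * sym_map W L (sym_prod W r (e j)) \<xi>)"
    by (auto simp: sym_map_def f)
  also have "\<dots> = (\<lambda>\<xi>. \<Sum>j<N. c j * sym_prod W r (\<lambda>i. L (e j i)) \<xi>)"
    using e by (simp add: sym_map_sym_prod[OF W L])
  also have "\<dots> \<in> Sym_end r W"
    using e L by (intro Sym_end_sum) (auto simp: lin_maps_def)
  finally show ?thesis .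
qed

text \<open>Holomorphy follows from the expansion in \<open>h_section_kappa\<close>: it is
  polynomial in the invariant sections \<open>\<kappa>\<close>, hence itself invariant.\<close>

lemma h_section_kappa_H0:
  assumes "0 < k"
  shows "h_section \<epsilon> k (kappa k r) \<in> (H0_Sym k r :: 'n::finite sym_section set)"
proof -
  let ?s = "h_section \<epsilon> k (kappa k r) :: 'n sym_section"
  have "?s W \<in> Sym_end r W" if W: "W \<in> Grass k" for W
    using W sym_map_Sym_end[OF GrassD(1)[OF W] h_end_linear[OF GrassD(1)[OF W]] kappa_Sym_end[OF W]]
    by (simp add: h_section_def)
  moreover have "?s W = 0" if "W \<notin> Grass k" for W
    using that by (simp add: h_section_def)
  moreover have "holomorphic_section k ?s"
    by (rule invariant_holomorphic_section)
       (simp add: h_section_kappa assms translate_Grass push_dual_in_dual_end kappa_invariant)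
  ultimately show ?thesis by (simp add: H0_Sym_def)
qed

subsection \<open>The expansion\<close>

text \<open>The determinant is the \<open>n\<close>-th power of a linear polynomial. The bound on
  \<open>i\<close> matters: beyond it, truncated subtraction would pick the constant
  coefficient.\<close>

lemma char_coeff_mat:
  assumes "i \<le> CARD('n)"
  shows "char_coeff (mat \<epsilon> :: complex^'n^'n) i = of_nat (CARD('n) choose i) * \<epsilon> ^ i"
proof -
  let ?M = "mat [:0, 1:] + (\<chi> p q. [:(mat \<epsilon> :: complex^'n^'n) $ p $ q:]) :: complex poly^'n^'n"
  have "det ?M = (\<Prod>p\<in>UNIV. ?M $ p $ p)"
    by (rule det_diagonal) (simp add: mat_def)
  also have "\<dots> = [:\<epsilon>, 1:] ^ CARD('n)"
    by (simp add: mat_def)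
  finally have "char_coeff (mat \<epsilon> :: complex^'n^'n) i = poly.coeff ([:\<epsilon>, 1:] ^ CARD('n)) (CARD('n) - i)"
    by (simp add: char_coeff_def)
  then show ?thesis
    using assms by (simp add: coeff_linear_poly_power binomial_symmetric[OF assms])
qed

lemma kappa_tilde_apply:
  fixes W :: "(complex^'n::finite) set"
  shows "kappa_tilde (mat \<epsilon>) k r W \<xi> = (\<Sum>i = 0..min r CARD('n).
    of_nat (CARD('n) choose i) * \<epsilon> ^ i * (kappa k (r - i) W \<xi> * kappa k 1 W \<xi> ^ i))"
  unfolding kappa_tilde_def sum_fun_apply
  by (intro sum.cong refl) (simp add: scale_section_def power_fun_apply char_coeff_mat)

text \<open>Here \<open>t\<close> stands for the value of \<open>\<kappa>\<^sub>1\<close> and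
  \<open>K i\<close> for that of \<open>\<kappa>\<^sub>i\<close>. The pairs \<open>(j, i)\<close>
  are collected by \<open>l = j + i\<close>, and Vandermonde's identity sums the products of
  binomial coefficients.\<close>

lemma vandermonde_sum:
  fixes K :: "nat \<Rightarrow> complex"
  assumes "m \<le> r"
  shows "(\<Sum>j = 0..m. \<epsilon> ^ j * of_nat (m choose j) * (t ^ j *
      (\<Sum>i = 0..min (r - j) n. of_nat (n choose i) * \<epsilon> ^ i * (K (r - j - i) * t ^ i)))) =
    (\<Sum>l\<le>r. of_nat ((m + n) choose l) * (\<epsilon> * t) ^ l * K (r - l))"
proof -
  let ?f = "\<lambda>j i. of_nat (m choose j) * of_nat (n choose i) * (\<epsilon> * t) ^ (j + i) * K (r - (j + i))"
  have "(\<Sum>j = 0..m. \<epsilon> ^ j * of_nat (m choose j) * (t ^ j *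
      (\<Sum>i = 0..min (r - j) n. of_nat (n choose i) * \<epsilon> ^ i * (K (r - j - i) * t ^ i)))) =
      (\<Sum>j = 0..m. \<Sum>i = 0..min (r - j) n. ?f j i)"
    by (simp add: sum_distrib_left power_add power_mult_distrib mult_ac)
  \<comment> \<open>Both ranges are enlarged to fill the triangle \<open>j + i \<le> r\<close>; the
    new terms vanish with their binomial coefficients.\<close>
  also have "\<dots> = (\<Sum>j = 0..m. \<Sum>i\<le>r - j. ?f j i)"
    by (intro sum.cong refl sum.mono_neutral_left) (auto simp: binomial_eq_0)
  also have "\<dots> = (\<Sum>j\<le>r. \<Sum>i\<le>r - j. ?f j i)"
    using assms by (intro sum.mono_neutral_left) (auto simp: binomial_eq_0)
  also have "\<dots> = (\<Sum>(j, i)\<in>{(j, i). j + i \<le> r}. ?f j i)"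
    by (subst sum.Sigma) (auto intro!: sum.cong)
  also have "\<dots> = (\<Sum>l\<le>r. \<Sum>j\<le>l. ?f j (l - j))"
    by (rule sum.triangle_reindex_eq)
  also have "\<dots> = (\<Sum>l\<le>r. of_nat (\<Sum>j\<le>l. (m choose j) * (n choose (l - j))) * (\<epsilon> * t) ^ l * K (r - l))"
    by (simp add: sum_distrib_right)
  finally show ?thesis by (simp only: vandermonde)
qed

theorem theorem6p9:
  fixes k r :: nat and \<epsilon> :: complex and B :: "complex^'n^'n"
  assumes "1 < k" and "k < CARD('n) - 1"
    and "r \<ge> CARD('n) - k + 1"
    and "B = mat \<epsilon>"
  shows "h_section \<epsilon> k (kappa k r) \<in> (H0_Sym k r :: 'n sym_section set) \<and>
    h_section \<epsilon> k (kappa k r) =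
      (\<Sum>j = 0..k + r - CARD('n) - 1.
        (\<epsilon> ^ j * of_nat ((k + r - CARD('n) - 1) choose j)) \<odot>
          (kappa k 1 ^ j * kappa_tilde B k (r - j)))"
proof (intro conjI ext)
  show "h_section \<epsilon> k (kappa k r) \<in> (H0_Sym k r :: 'n sym_section set)"
    using assms by (intro h_section_kappa_H0) simp
next
  let ?m = "k + r - CARD('n) - 1"
  fix W :: "(complex^'n) set" and \<xi>
  \<comment> \<open>The lower bound on \<open>r\<close> makes the subtraction in \<open>?m\<close>
    exact, and \<open>?m \<le> r\<close> comes from \<open>k\<close> being below the
    dimension.\<close>
  have m: "?m + CARD('n) = k + r - 1" "?m \<le> r" using assms by auto
  have rhs: "(\<Sum>j = 0..?m. (\<epsilon> ^ j * of_nat (?m choose j)) \<odot> (kappa k 1 ^ j * kappa_tilde B k (r - j))) W \<xi> =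
      (\<Sum>l\<le>r. of_nat ((k + r - 1) choose l) * (\<epsilon> * kappa k 1 W \<xi>) ^ l * kappa k (r - l) W \<xi>)"
    using vandermonde_sum[OF m(2), of \<epsilon> "kappa k 1 W \<xi>" "CARD('n)" "\<lambda>i. kappa k i W \<xi>"]
    by (simp only: sum_fun_apply scale_section_def times_fun_apply power_fun_apply assms(4)
        kappa_tilde_apply m(1))
  show "h_section \<epsilon> k (kappa k r) W \<xi> =
      (\<Sum>j = 0..?m. (\<epsilon> ^ j * of_nat (?m choose j)) \<odot> (kappa k 1 ^ j * kappa_tilde B k (r - j))) W \<xi>"
  proof (cases "W \<in> Grass k \<and> \<xi> \<in> dual_end W")
    case True
    then show ?thesis unfolding rhs using assms(1) by (intro h_section_kappa) auto
  next
    case False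
    then have "h_section \<epsilon> k (kappa k r) W \<xi> = 0"
      by (auto simp: h_section_def sym_map_def)
    \<comment> \<open>Every term of the expanded right-hand side has a factor
      \<open>kappa k (r - l)\<close>, so it vanishes even for \<open>l = 0\<close>, where the power
      is 1.\<close>
    moreover have "kappa k i W \<xi> = 0" for i
      using False kappa_outside[of W] kappa_outside_dual[of \<xi>] by (metis zero_fun_apply)
    ultimately show ?thesis unfolding rhs by simp
  qed
qed

end
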